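(* Let $x,y$ be complex numbers such that $|x|^2+|y|^4<1$. Then $$\sum_{k=1}^{\infty}\frac{k}{k^4-x^2k^2-y^4}=\frac{1}{2}\sum_{n=1}^{\infty}\frac{(-1)^{n-1}r(n)}{n\binom{2n}{n}}\,\frac{\prod_{m=1}^{n-1}\big((m^2-x^2)^2+4y^4\big)}{\prod_{m=n}^{2n}(m^4-x^2m^2-y^4)},$$ where $$r(n)=205n^6-160n^5+(32-62x^2)n^4+40x^2n^3+(x^4-8x^2-25y^4)n^2+10y^4n+y^4(x^2-2).$$
   Context: An empty product equals $1$. *)

theory Defs
  imports "HOL-Analysis.Analysis"
begin

definition r_poly :: "complex \<Rightarrow> complex \<Rightarrow> nat \<Rightarrow> complex" where
  "r_poly x y n =
     205 * of_nat n ^ 6 - 160 * of_nat n ^ 5 + (32 - 62 * x^2) * of_nat n ^ 4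
     + 40 * x^2 * of_nat n ^ 3 + (x^4 - 8 * x^2 - 25 * y^4) * of_nat n ^ 2
     + 10 * y^4 * of_nat n + y^4 * (x^2 - 2)"

definition lhs_term :: "complex \<Rightarrow> complex \<Rightarrow> nat \<Rightarrow> complex" where
  "lhs_term x y k = of_nat k / (of_nat k ^ 4 - x^2 * of_nat k ^ 2 - y^4)"

(* Only used for n \<ge> 1, so the truncated subtraction n - 1 is the genuine one. *)
definition rhs_term :: "complex \<Rightarrow> complex \<Rightarrow> nat \<Rightarrow> complex" where
  "rhs_term x y n =
     ((-1) ^ (n - 1) * r_poly x y n) / (of_nat n * of_nat ((2 * n) choose n))
     * ((\<Prod>m\<in>{1..n - 1}. (of_nat m ^ 2 - x^2)^2 + 4 * y^4)
        / (\<Prod>m\<in>{n..2 * n}. of_nat m ^ 4 - x^2 * of_nat m ^ 2 - y^4))"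

end

theory Submission
  imports Defs
begin

text \<open>
  A Markov--WZ argument. Put \<open>P m = m^4 - x^2 m^2 - y^4\<close> and \<open>Q m = (m^2 - x^2)^2 + 4 y^4\<close>. The kernel
  \<open>F n k = c n * (3n + 2k + 2) / (P (n+k+1) \<cdots> P (2n+k+1))\<close>, where \<open>c n\<close> is the product of
  \<open>- m * Q m / (2 * (2m - 1))\<close> over \<open>1 \<le> m \<le> n\<close>, is the summand of a very-well-poised series; it has
  a rational companion \<open>G\<close> with \<open>F n k - F (n+1) k = G n k - G n (k+1)\<close>. Summing over \<open>k\<close>, the row sums
  \<open>S n = (\<Sum>k. F n k)\<close> satisfy \<open>S n - S (n+1) = G n 0\<close>. Here \<open>S 0\<close> is twice the left-hand series,
  \<open>G n 0\<close> is the term of index \<open>n+1\<close> of the right-hand series, and \<open>S n\<close> tends to \<open>0\<close> geometrically.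
\<close>

section \<open>The kernel, its companion and the WZ relation\<close>

definition quartic :: "complex \<Rightarrow> complex \<Rightarrow> nat \<Rightarrow> complex" where
  "quartic x y m = of_nat m ^ 4 - x^2 * of_nat m ^ 2 - y^4"

definition wz_ratio :: "complex \<Rightarrow> complex \<Rightarrow> nat \<Rightarrow> complex" where
  "wz_ratio x y m =
     - of_nat m * ((of_nat m ^ 2 - x^2)^2 + 4 * y^4) / (2 * (2 * of_nat m - 1))"

definition wz_coeff :: "complex \<Rightarrow> complex \<Rightarrow> nat \<Rightarrow> complex" where
  "wz_coeff x y n = (\<Prod>m\<in>{1..n}. wz_ratio x y m)"

text \<open>
  Found by solving the linear system that the relation between \<open>F\<close> and \<open>G\<close> imposes on an unknown
  polynomial; here \<open>N\<close> stands for \<open>n + 1\<close>, \<open>X\<close> for \<open>x^2\<close> and \<open>Y\<close> for \<open>y^4\<close>. The part free of \<open>k\<close>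
  is \<open>r(N)\<close>.
\<close>
definition wz_cert :: "complex \<Rightarrow> complex \<Rightarrow> complex \<Rightarrow> complex \<Rightarrow> complex" where
  "wz_cert X Y N k =
     (205*N^6 - 160*N^5 + (32 - 62*X)*N^4 + 40*X*N^3 + (X^2 - 8*X - 25*Y)*N^2 + 10*Y*N + Y*(X - 2))
     + (574*N^5 - 384*N^4 + (64 - 120*X)*N^3 + 56*X*N^2 + (2*X^2 - 8*X - 18*Y)*N + 4*Y) * k
     + (664*N^4 - 368*N^3 + (48 - 85*X)*N^2 + 26*X*N + (X^2 - 2*X - 2*Y)) * k^2
     + (408*N^3 - 176*N^2 + (16 - 26*X)*N + 4*X) * k^3
     + (141*N^2 - 42*N + (2 - 3*X)) * k^4
     + (26*N - 4) * k^5
     + 2 * k^6"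

definition wz_F :: "complex \<Rightarrow> complex \<Rightarrow> nat \<Rightarrow> nat \<Rightarrow> complex" where
  "wz_F x y n k =
     wz_coeff x y n * of_nat (3*n + 2*k + 2) / (\<Prod>m\<in>{n+k+1..2*n+k+1}. quartic x y m)"

definition wz_G :: "complex \<Rightarrow> complex \<Rightarrow> nat \<Rightarrow> nat \<Rightarrow> complex" where
  "wz_G x y n k =
     wz_coeff x y n * wz_cert (x^2) (y^4) (of_nat (n+1)) (of_nat k)
       / (2 * of_nat (2*n+1) * (\<Prod>m\<in>{n+k+1..2*n+k+2}. quartic x y m))"

text \<open>This is the WZ relation with common factors cleared. For \<open>N = n + 1\<close> the
  values of \<open>p\<close> are the quartics at \<open>n+k+1\<close>, \<open>2*n+k+2\<close> and
  \<open>2*n+k+3\<close>, those not shared by all four denominators. What remains is polynomial in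
  \<open>X\<close>, \<open>Y\<close>, \<open>N\<close>, \<open>k\<close>.\<close>

lemma wz_cert_identity:
  fixes X Y N k :: complex
  defines "p \<equiv> \<lambda>m. m^4 - X*m^2 - Y"
  shows "2*(2*N-1)*(3*N+2*k-1) * p (2*N+k) * p (2*N+k+1)
           + N*((N^2-X)^2 + 4*Y)*(3*N+2*k+2) * p (N+k)
         = wz_cert X Y N k * p (2*N+k+1) - wz_cert X Y N (k+1) * p (N+k)"
  unfolding p_def wz_cert_def by algebra

lemma wz_coeff_Suc: "wz_coeff x y (Suc n) = wz_coeff x y n * wz_ratio x y (Suc n)"
  by (simp add: wz_coeff_def)

text \<open>All four denominators contain the block \<open>R\<close> (empty for
  \<open>n = 0\<close>); they differ only in the factors \<open>A\<close>, \<open>B\<close>,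
  \<open>C\<close> and \<open>2*(2*N-1)\<close>. Over a common denominator the claim becomes
  \<open>wz_cert_identity\<close>.\<close>

lemma wz_relation:
  assumes nz: "\<And>m. m \<ge> 1 \<Longrightarrow> quartic x y m \<noteq> 0"
  shows "wz_F x y n k - wz_F x y (Suc n) k = wz_G x y n k - wz_G x y n (Suc k)"
proof -
  define R where "R = (\<Prod>m\<in>{n+k+2..2*n+k+1}. quartic x y m)"
  define N k' :: complex where "N = of_nat (n+1)" and "k' = of_nat k"
  define c where "c = wz_coeff x y n"
  define A B C where "A = quartic x y (n+k+1)" and "B = quartic x y (2*n+k+2)"
    and "C = quartic x y (2*n+k+3)"
  have R0: "R \<noteq> 0" and ABC: "A \<noteq> 0" "B \<noteq> 0" "C \<noteq> 0"
    unfolding R_def A_def B_def C_def by (auto simp: nz)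
  have D0: "2*N-1 \<noteq> 0"
  proof -
    have "2*N - 1 = of_nat (2*n+1)" by (simp add: N_def)
    then show ?thesis by (simp only: of_nat_eq_0_iff)
  qed
  have p1: "(\<Prod>m\<in>{n+k+1..2*n+k+1}. quartic x y m) = A * R"
    unfolding A_def R_def by (subst prod.atLeast_Suc_atMost) (auto simp: add.commute)
  have p2: "(\<Prod>m\<in>{n+k+1..2*n+k+2}. quartic x y m) = A * R * B"
  proof -
    have "{n+k+1..2*n+k+2} = insert (2*n+k+2) {n+k+1..2*n+k+1}" by auto
    then show ?thesis using p1 by (simp add: B_def mult.commute)
  qed
  have p3: "(\<Prod>m\<in>{n+Suc k+1..2*n+Suc k+2}. quartic x y m) = R * B * C"
  proof -
    have "{n+Suc k+1..2*n+Suc k+2} = insert (2*n+k+3) (insert (2*n+k+2) {n+k+2..2*n+k+1})" by auto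
    then show ?thesis by (simp add: B_def C_def R_def mult_ac)
  qed
  have p4: "(\<Prod>m\<in>{Suc n+k+1..2*Suc n+k+1}. quartic x y m) = R * B * C"
    using p3 by simp
  have A': "A = (N+k')^4 - x^2*(N+k')^2 - y^4" and B': "B = (2*N+k')^4 - x^2*(2*N+k')^2 - y^4"
    and C': "C = (2*N+k'+1)^4 - x^2*(2*N+k'+1)^2 - y^4"
    by (simp_all add: A_def B_def C_def quartic_def N_def k'_def algebra_simps)
  have key: "2*(2*N-1)*(3*N+2*k'-1) * B * C + N*((N^2-x^2)^2 + 4*y^4)*(3*N+2*k'+2) * A
         = wz_cert (x^2) (y^4) N k' * C - wz_cert (x^2) (y^4) N (k'+1) * A"
    unfolding A' B' C' by (rule wz_cert_identity)
  \<comment> \<open>With \<open>n = N - 1\<close>, the numerator \<open>3*n+2*k+2\<close> reads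
    \<open>3*N+2*k'-1\<close>.\<close>
  have F1: "wz_F x y n k = c * (3*N+2*k'-1) / (A*R)"
    unfolding wz_F_def p1 by (simp add: c_def N_def k'_def algebra_simps)
  have F2: "wz_F x y (Suc n) k =
      c * (- N*((N^2-x^2)^2 + 4*y^4) / (2*(2*N-1))) * (3*N+2*k'+2) / (R*B*C)"
    unfolding wz_F_def p4 wz_coeff_Suc wz_ratio_def
    by (simp add: c_def N_def k'_def algebra_simps)
  have G1: "wz_G x y n k = c * wz_cert (x^2) (y^4) N k' / (2*(2*N-1)*(A*R*B))"
    unfolding wz_G_def p2 by (simp add: c_def N_def k'_def algebra_simps)
  have G2: "wz_G x y n (Suc k) = c * wz_cert (x^2) (y^4) N (k'+1) / (2*(2*N-1)*(R*B*C))"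
    unfolding wz_G_def p3 by (simp add: c_def N_def k'_def algebra_simps)
  have "wz_F x y n k - wz_F x y (Suc n) k
      = c * (2*(2*N-1)*(3*N+2*k'-1) * B * C + N*((N^2-x^2)^2 + 4*y^4)*(3*N+2*k'+2) * A)
          / (2*(2*N-1)*A*R*B*C)"
    unfolding F1 F2 using R0 ABC D0 by (simp add: divide_simps) algebra
  also have "\<dots> = wz_G x y n k - wz_G x y n (Suc k)"
    unfolding key G1 G2 using R0 ABC D0 by (simp add: divide_simps) algebra
  finally show ?thesis .
qed

section \<open>The boundary term at \<open>k = 0\<close>\<close>

text \<open>The product over \<open>m\<close> is the reciprocal of \<open>(2*n) choose n\<close>,
  since consecutive central binomial coefficients have ratio \<open>2*(2*m-1)/m\<close>.\<close>

lemma central_binomial_prod: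
  "of_nat (Suc n) * of_nat ((2 * Suc n) choose (Suc n)) * (\<Prod>m\<in>{1..n}. of_nat m / (2 * (2 * of_nat m - 1)))
     = (2 * of_nat (2*n+1) :: 'a::field_char_0)"
proof (induction n)
  case (Suc n)
  let ?b = "\<lambda>n. of_nat ((2 * n) choose n) :: 'a"
  let ?p = "\<Prod>m\<in>{1..n}. of_nat m / (2 * (2 * of_nat m - 1)) :: 'a"
  have step: "of_nat (Suc (Suc n)) * ?b (Suc (Suc n)) = 2 * of_nat (2*n+3) * ?b (Suc n)"
  proof -
    have b: "?b n = fact (2*n) / (fact n * fact n)" for n
      by (simp add: binomial_fact)
    have nz: "of_nat (Suc (Suc n)) \<noteq> (0::'a)" by (rule of_nat_neq_0)
    have "fact (2 * Suc (Suc n)) = 2 * of_nat (Suc (Suc n)) * of_nat (2*n+3) * (fact (2 * Suc n) :: 'a)"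
      by (simp add: algebra_simps)
    moreover have "fact (Suc (Suc n)) = of_nat (Suc (Suc n)) * (fact (Suc n) :: 'a)"
      by (rule fact_Suc)
    ultimately show ?thesis unfolding b using nz by (simp only:) (simp add: divide_simps del: of_nat_Suc fact_Suc)
  qed
  have d: "2 * of_nat (Suc n) - 1 = (of_nat (2*n+1) :: 'a)"
    by simp
  have nz: "of_nat (2*n+1) \<noteq> (0::'a)"
    by (simp only: of_nat_eq_0_iff)
  have "of_nat (Suc (Suc n)) * ?b (Suc (Suc n)) * (\<Prod>m\<in>{1..Suc n}. of_nat m / (2 * (2 * of_nat m - 1)))
      = 2 * of_nat (2*n+3) * (of_nat (Suc n) * ?b (Suc n) * ?p) / (2 * (2 * of_nat (Suc n) - 1))"
    unfolding step by simp
  also have "\<dots> = 2 * of_nat (2*n+3)"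
  proof -
    have "a * (2 * b) / (2 * b) = a" if "b \<noteq> 0" for a b :: 'a
      using that by simp
    then show ?thesis unfolding Suc.IH d using nz by blast
  qed
  also have "2*n+3 = 2 * Suc n + 1"
    by simp
  finally show ?case .
qed simp

text \<open>The coefficient splits into a sign, the central binomial part \<open>?h\<close> and the
  product \<open>?q\<close>. At \<open>k = 0\<close> the certificate reduces to
  \<open>r_poly\<close>, and the denominator range \<open>n+1..2*n+2\<close> is the one for index
  \<open>n+1\<close>.\<close>

lemma wz_G_0: "wz_G x y n 0 = rhs_term x y (Suc n)"
proof -
  let ?q = "\<Prod>m\<in>{1..n}. (of_nat m ^ 2 - x^2)^2 + 4 * y^4"
  let ?h = "\<Prod>m\<in>{1..n}. of_nat m / (2 * (2 * of_nat m - 1)) :: complex"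
  let ?b = "of_nat (Suc n) * of_nat ((2 * Suc n) choose (Suc n)) :: complex"
  have "wz_ratio x y = (\<lambda>m. - 1 * (of_nat m / (2 * (2 * of_nat m - 1))) * ((of_nat m ^ 2 - x^2)^2 + 4 * y^4))"
    by (simp add: wz_ratio_def fun_eq_iff)
  then have c: "wz_coeff x y n = (-1)^n * ?h * ?q"
    unfolding wz_coeff_def by (simp only: prod.distrib prod_constant) simp
  have d0: "2 * of_nat (2*n+1) \<noteq> (0::complex)"
    by (simp only: mult_eq_0_iff of_nat_eq_0_iff) simp
  have bh: "?b * ?h = 2 * of_nat (2*n+1)"
    by (rule central_binomial_prod)
  have "h / s = 1 / b" if "b * h = s" "s \<noteq> 0" for b h s :: complex
    using that by auto
  from this[OF bh d0] have h: "?h / (2 * of_nat (2*n+1)) = 1 / ?b" .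
  have r: "wz_cert (x^2) (y^4) (of_nat (n+1)) (of_nat 0) = r_poly x y (Suc n)"
    by (simp add: wz_cert_def r_poly_def flip: power_mult)
  have "wz_G x y n 0 = (-1)^n * ?q * r_poly x y (Suc n) * (?h / (2 * of_nat (2*n+1)))
      / (\<Prod>m\<in>{Suc n..2 * Suc n}. quartic x y m)"
    unfolding wz_G_def c r by simp
  also have "\<dots> = rhs_term x y (Suc n)"
    unfolding h rhs_term_def quartic_def by simp
  finally show ?thesis .
qed

section \<open>Comparison sequences in \<open>k\<close>\<close>

lemma summable_inverse_squares_Suc: "summable (\<lambda>k. 1 / real (Suc k) ^ 2)"
  using inverse_power_summable[of 2, where 'a = real]
  by (subst summable_Suc_iff) (simp add: inverse_eq_divide)

lemma power_over_Suc_power_tendsto_0: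
  assumes "i < j"
  shows "(\<lambda>k. real k ^ i / real (Suc k) ^ j) \<longlonglongrightarrow> 0"
proof (rule Lim_null_comparison)
  show "\<forall>\<^sub>F k in sequentially. norm (real k ^ i / real (Suc k) ^ j) \<le> 1 / real (Suc k)"
  proof (intro always_eventually allI)
    fix k
    have "real k ^ i * real (Suc k) \<le> real (Suc k) ^ i * real (Suc k)"
      by (intro mult_right_mono power_mono) auto
    also have "\<dots> = real (Suc k) ^ Suc i" by simp
    also have "\<dots> \<le> real (Suc k) ^ j" using assms by (intro power_increasing) auto
    finally show "norm (real k ^ i / real (Suc k) ^ j) \<le> 1 / real (Suc k)"
      by (simp add: divide_simps mult.commute)
  qed
  show "(\<lambda>k. 1 / real (Suc k)) \<longlonglongrightarrow> 0"
    using LIMSEQ_inverse_real_of_nat by (simp add: inverse_eq_divide)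
qed

text \<open>The certificate has degree 6 in \<open>k\<close>. The exponent 8 is what two quartic
  factors in the denominator of \<open>wz_G\<close> supply.\<close>

lemma wz_cert_tendsto_0: "(\<lambda>k. wz_cert X Y N (of_nat k) / of_nat (Suc k) ^ 8) \<longlonglongrightarrow> (0::complex)"
proof -
  have mono: "(\<lambda>k. c * (of_nat k ^ i / of_nat (Suc k) ^ 8)) \<longlonglongrightarrow> (0::complex)"
    if "i < 8" for i :: nat and c :: complex
  proof -
    have "(\<lambda>k. complex_of_real (real k ^ i / real (Suc k) ^ 8)) \<longlonglongrightarrow> of_real 0"
      by (intro tendsto_of_real power_over_Suc_power_tendsto_0 that)
    then show ?thesis by (intro tendsto_mult_right_zero) simp
  qed
  have "(\<lambda>k. (a0 + a1 * of_nat k + a2 * of_nat k ^ 2 + a3 * of_nat k ^ 3 + a4 * of_nat k ^ 4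
        + a5 * of_nat k ^ 5 + a6 * of_nat k ^ 6) / of_nat (Suc k) ^ 8) \<longlonglongrightarrow> (0::complex)"
    for a0 a1 a2 a3 a4 a5 a6
    unfolding add_divide_distrib times_divide_eq_right[symmetric]
    \<comment> \<open>The exponents 0 and 1 are not written as powers in the sum, so these two
      instances are supplied separately.\<close>
    using mono[of 0 a0] mono[of 1 a1]
    by (intro tendsto_add_zero mono) simp_all
  then show ?thesis unfolding wz_cert_def .
qed

section \<open>Estimates in the region of convergence\<close>

context
  fixes x y :: complex
  assumes small: "cmod x ^ 2 + cmod y ^ 4 < 1"
begin

lemma quartic_lower:
  assumes "m \<ge> 1"
  shows "real m ^ 4 - (cmod x ^ 2 + cmod y ^ 4) * real m ^ 2 \<le> cmod (quartic x y m)"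
proof -
  have "cmod (x^2 * of_nat m ^ 2 + y^4) \<le> cmod x ^ 2 * real m ^ 2 + cmod y ^ 4"
    by (rule order.trans[OF norm_triangle_ineq]) (simp add: norm_mult norm_power)
  moreover have "cmod y ^ 4 \<le> cmod y ^ 4 * real m ^ 2"
    using assms mult_left_mono[of 1 "real m ^ 2" "cmod y ^ 4"] by simp
  moreover have "cmod (of_nat m ^ 4) - cmod (x^2 * of_nat m ^ 2 + y^4) \<le> cmod (quartic x y m)"
    unfolding quartic_def diff_diff_eq by (rule norm_triangle_ineq2)
  ultimately show ?thesis by (simp add: norm_power algebra_simps)
qed

text \<open>Holding already from \<open>m = 1\<close>, this bound gives nonvanishing and the decay
  in \<open>k\<close>; its constant degenerates at the boundary of the region.\<close>

lemma quartic_lower_delta: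
  assumes "m \<ge> 1"
  shows "(1 - cmod x ^ 2 - cmod y ^ 4) * real m ^ 4 \<le> cmod (quartic x y m)"
proof -
  have "real m ^ 2 \<le> real m ^ 4" using assms by (intro power_increasing) auto
  then have "(cmod x ^ 2 + cmod y ^ 4) * real m ^ 2 \<le> (cmod x ^ 2 + cmod y ^ 4) * real m ^ 4"
    by (intro mult_left_mono) auto
  then show ?thesis using quartic_lower[OF assms] by (simp add: algebra_simps)
qed

lemma quartic_nonzero: "m \<ge> 1 \<Longrightarrow> quartic x y m \<noteq> 0"
  using quartic_lower_delta[of m] small by (auto simp: mult_le_0_iff power_le_zero_eq)

text \<open>From \<open>m = 2\<close> on, the correction is at most \<open>m^2\<close>, hence at
  most a quarter of \<open>m^4\<close>. The constant is free of \<open>x\<close> and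
  \<open>y\<close>, which yields a fixed geometric ratio in \<open>n\<close>.\<close>

lemma quartic_lower_three_quarters:
  assumes "m \<ge> 2"
  shows "3/4 * real m ^ 4 \<le> cmod (quartic x y m)"
proof -
  have "(cmod x ^ 2 + cmod y ^ 4) * real m ^ 2 \<le> real m ^ 2"
    using small mult_right_mono[of "cmod x ^ 2 + cmod y ^ 4" 1 "real m ^ 2"] by simp
  moreover have "4 * real m ^ 2 \<le> real m ^ 2 * real m ^ 2"
    using power_mono[of 2 "real m" 2] assms by (intro mult_right_mono) auto
  moreover have "real m ^ 2 * real m ^ 2 = real m ^ 4" by (simp flip: power_add)
  ultimately show ?thesis using quartic_lower[of m] assms by linarith
qed

lemma wz_ratio_upper:
  assumes "m \<ge> 1"
  shows "cmod (wz_ratio x y m) \<le> 4 * real m ^ 4"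
proof -
  have m1: "1 \<le> real m" using assms by simp
  then have m2: "1 \<le> real m ^ 2" and m4: "1 \<le> real m ^ 4" by simp_all
  have "cmod (of_nat m ^ 2 - x^2) \<le> real m ^ 2 + cmod x ^ 2"
    by (rule order.trans[OF norm_triangle_ineq4]) (simp add: norm_power)
  also have "\<dots> \<le> 2 * real m ^ 2"
    using small m2 zero_le_power[OF norm_ge_zero, of y 4] by linarith
  finally have "cmod (of_nat m ^ 2 - x^2) ^ 2 \<le> (2 * real m ^ 2) ^ 2"
    by (intro power_mono) auto
  then have "cmod ((of_nat m ^ 2 - x^2)^2) \<le> 4 * real m ^ 4"
    by (simp add: norm_power power_mult_distrib flip: power_mult)
  moreover have "cmod (4 * y^4) \<le> 4"
  proof -
    have "0 \<le> cmod x ^ 2" by simp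
    then have "cmod y ^ 4 \<le> 1" using small by linarith
    then show ?thesis by (simp add: norm_mult norm_power)
  qed
  ultimately have q: "cmod ((of_nat m ^ 2 - x^2)^2 + 4 * y^4) \<le> 8 * real m ^ 4"
    using norm_triangle_ineq[of "(of_nat m ^ 2 - x^2)^2" "4 * y^4"] m4 by linarith
  have "2 * of_nat m - 1 = (of_real (2 * real m - 1) :: complex)" by simp
  then have d: "cmod (2 * of_nat m - 1) = 2 * real m - 1"
    using m1 by (simp only: norm_of_real)
  have "cmod (wz_ratio x y m)
      = (real m / (2 * real m - 1)) * cmod ((of_nat m ^ 2 - x^2)^2 + 4 * y^4) / 2"
    unfolding wz_ratio_def norm_divide norm_mult norm_minus_cancel d by simp
  also have "\<dots> \<le> 1 * (8 * real m ^ 4) / 2"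
    using m1 q by (intro divide_right_mono mult_mono) auto
  finally show ?thesis by simp
qed

text \<open>Pair the \<open>j\<close>-th factor of the coefficient with the quartic at
  \<open>j+n+k\<close>, which is at least \<open>2*j\<close>. Each quotient is then at most
  \<open>4*j^4 / (3/4 * (2*j)^4) = 1/3\<close>.\<close>

lemma wz_quotient_upper:
  "cmod (wz_coeff x y n / (\<Prod>m\<in>{n+k+1..2*n+k}. quartic x y m)) \<le> (1/3) ^ n"
proof -
  have shift: "(\<Prod>m\<in>{n+k+1..2*n+k}. quartic x y m) = (\<Prod>j\<in>{1..n}. quartic x y (j + (n+k)))"
    using prod.shift_bounds_cl_nat_ivl[of "quartic x y" 1 "n+k" n] by (simp add: ac_simps mult_2_right)
  have le: "cmod (wz_ratio x y j / quartic x y (j + (n+k))) \<le> 1/3" if "j \<in> {1..n}" for j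
  proof -
    have "2 * real j \<le> real (j + (n+k))" using that by simp
    then have "(2 * real j) ^ 4 \<le> real (j + (n+k)) ^ 4" by (intro power_mono) auto
    \<comment> \<open>Here \<open>j+n+k\<close> is at least 2, because \<open>n\<close> and
      \<open>j\<close> are both at least 1.\<close>
    then have "12 * real j ^ 4 \<le> cmod (quartic x y (j + (n+k)))"
      using quartic_lower_three_quarters[of "j + (n+k)"] that by simp
    then have "cmod (wz_ratio x y j) / cmod (quartic x y (j + (n+k))) \<le> 4 * real j ^ 4 / (12 * real j ^ 4)"
      using wz_ratio_upper[of j] that by (intro frac_le) auto
    also have "\<dots> = 1/3" using that by simp
    finally show ?thesis by (simp add: norm_divide)
  qed
  have "wz_coeff x y n / (\<Prod>m\<in>{n+k+1..2*n+k}. quartic x y m)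
      = (\<Prod>j\<in>{1..n}. wz_ratio x y j / quartic x y (j + (n+k)))"
    unfolding shift wz_coeff_def by (simp add: prod_dividef)
  also have "cmod \<dots> \<le> (\<Prod>j\<in>{1..n}. 1/3)"
    unfolding prod_norm[symmetric] using le by (intro prod_mono) auto
  finally show ?thesis by simp
qed

text \<open>One quartic, at \<open>u = 2*n+k+1\<close>, is left over from
  \<open>wz_quotient_upper\<close>. The numerator is at most \<open>3*u\<close>, so this factor
  gives a summable bound in \<open>k\<close> that is uniform in \<open>n\<close>.\<close>

lemma wz_F_upper:
  "cmod (wz_F x y n k) \<le> (1/3) ^ n * (3 / (1 - cmod x ^ 2 - cmod y ^ 4)) * (1 / real (Suc k) ^ 2)"
proof -
  define d where "d = 1 - cmod x ^ 2 - cmod y ^ 4"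
  have d: "d > 0" using small by (simp add: d_def)
  define u where "u = real (2*n+k+1)"
  have u: "real (Suc k) \<le> u" "1 \<le> u" by (simp_all add: u_def)
  have "{n+k+1..2*n+k+1} = insert (2*n+k+1) {n+k+1..2*n+k}" by auto
  then have "wz_F x y n k = wz_coeff x y n / (\<Prod>m\<in>{n+k+1..2*n+k}. quartic x y m)
      * (of_nat (3*n+2*k+2) / quartic x y (2*n+k+1))"
    unfolding wz_F_def by (simp add: mult_ac)
  then have "cmod (wz_F x y n k) = cmod (wz_coeff x y n / (\<Prod>m\<in>{n+k+1..2*n+k}. quartic x y m))
      * cmod (of_nat (3*n+2*k+2) / quartic x y (2*n+k+1))"
    by (simp only: norm_mult)
  also have "cmod (of_nat (3*n+2*k+2) / quartic x y (2*n+k+1)) \<le> 3 / d * (1 / real (Suc k) ^ 2)"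
  proof -
    have "cmod (of_nat (3*n+2*k+2) / quartic x y (2*n+k+1)) \<le> (3 * u) / (d * u ^ 4)"
      using quartic_lower_delta[of "2*n+k+1"] d u
      by (auto simp: norm_divide u_def d_def simp del: of_nat_Suc of_nat_add intro!: frac_le mult_pos_pos)
        auto
    also have "\<dots> = 3 / d * (1 / u ^ 3)"
      using u d by (simp add: field_simps power_eq_if)
    also have "\<dots> \<le> 3 / d * (1 / real (Suc k) ^ 2)"
    proof -
      have "real (Suc k) ^ 2 \<le> u ^ 2" using u by (intro power_mono) auto
      also have "\<dots> \<le> u ^ 3" using u by (intro power_increasing) auto
      finally show ?thesis using d by (intro mult_left_mono frac_le) auto
    qed
    finally show ?thesis .
  qed
  finally have "cmod (wz_F x y n k)
      \<le> cmod (wz_coeff x y n / (\<Prod>m\<in>{n+k+1..2*n+k}. quartic x y m)) * (3 / d * (1 / real (Suc k) ^ 2))"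
    by (simp add: mult_left_mono)
  also have "\<dots> \<le> (1/3) ^ n * (3 / d * (1 / real (Suc k) ^ 2))"
    using d by (intro mult_right_mono wz_quotient_upper) auto
  finally show ?thesis by (simp add: d_def)
qed

section \<open>Row sums and telescoping\<close>

lemma wz_F_summable: "summable (wz_F x y n)"
  by (rule summable_comparison_test'[OF summable_mult[OF summable_inverse_squares_Suc] wz_F_upper])

lemma wz_row_sums_tendsto_0: "(\<lambda>n. \<Sum>k. wz_F x y n k) \<longlonglongrightarrow> 0"
proof (rule Lim_null_comparison)
  define K where "K = 3 / (1 - cmod x ^ 2 - cmod y ^ 4)"
  define Z where "Z = (\<Sum>k. 1 / real (Suc k) ^ 2)"
  have "norm (\<Sum>k. wz_F x y n k) \<le> (1/3) ^ n * (K * Z)" for n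
  proof -
    have "norm (\<Sum>k. wz_F x y n k) \<le> (\<Sum>k. (1/3) ^ n * K * (1 / real (Suc k) ^ 2))"
      unfolding K_def
      by (rule norm_suminf_le[OF wz_F_upper summable_mult[OF summable_inverse_squares_Suc]])
    also have "\<dots> = (1/3) ^ n * K * Z"
      unfolding Z_def by (rule suminf_mult[OF summable_inverse_squares_Suc])
    finally show ?thesis by (simp add: mult.assoc)
  qed
  then show "\<forall>\<^sub>F n in sequentially. norm (\<Sum>k. wz_F x y n k) \<le> (1/3) ^ n * (K * Z)" by simp
  show "(\<lambda>n. (1/3) ^ n * (K * Z)) \<longlonglongrightarrow> 0"
    by (intro tendsto_mult_left_zero LIMSEQ_power_zero) simp
qed

text \<open>Beyond the factors bounded by \<open>wz_quotient_upper\<close>, two quartics remain in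
  the denominator. They grow like \<open>k^8\<close>, faster than the certificate.\<close>

lemma wz_G_tendsto_0: "wz_G x y n \<longlonglongrightarrow> 0"
proof (rule Lim_null_comparison)
  define d where "d = 1 - cmod x ^ 2 - cmod y ^ 4"
  have d: "d > 0" using small by (simp add: d_def)
  let ?T = "\<lambda>k. wz_cert (x^2) (y^4) (of_nat (n+1)) (of_nat k)"
  show "\<forall>\<^sub>F k in sequentially. norm (wz_G x y n k) \<le> 1 / d^2 * norm (?T k / of_nat (Suc k) ^ 8)"
  proof (intro always_eventually allI)
    fix k
    let ?A = "quartic x y (2*n+k+1)" and ?B = "quartic x y (2*n+k+2)"
    let ?w = "wz_coeff x y n / (\<Prod>m\<in>{n+k+1..2*n+k}. quartic x y m)"
    have low: "d * real (Suc k) ^ 4 \<le> cmod (quartic x y m)" if "Suc k \<le> m" for m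
    proof -
      have "d * real (Suc k) ^ 4 \<le> d * real m ^ 4"
        using d that by (intro mult_left_mono power_mono) auto
      then show ?thesis using quartic_lower_delta[of m] that by (simp add: d_def)
    qed
    have "(d * real (Suc k) ^ 4) * (d * real (Suc k) ^ 4) \<le> cmod ?A * cmod ?B"
      using d by (intro mult_mono low) auto
    also have "(d * real (Suc k) ^ 4) * (d * real (Suc k) ^ 4) = d^2 * real (Suc k) ^ 8"
      by (simp add: power2_eq_square flip: power_add)
    finally have AB: "d^2 * real (Suc k) ^ 8 \<le> cmod ?A * cmod ?B" .
    have pos: "0 < d^2 * real (Suc k) ^ 8" using d by simp
    have w: "cmod ?w \<le> 1"
      using wz_quotient_upper[of n k] power_le_one[of "1/3::real" n] by linarith
    have "{n+k+1..2*n+k+2} = insert (2*n+k+2) (insert (2*n+k+1) {n+k+1..2*n+k})" by auto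
    then have "wz_G x y n k = ?w * (1 / (2 * of_nat (2*n+1))) * (?T k / (?A * ?B))"
      unfolding wz_G_def by (simp add: mult_ac)
    then have "norm (wz_G x y n k) = cmod ?w * cmod (1 / (2 * of_nat (2*n+1))) * (cmod (?T k) / (cmod ?A * cmod ?B))"
      by (simp only: norm_mult norm_divide)
    also have "\<dots> \<le> 1 * 1 * (cmod (?T k) / (d^2 * real (Suc k) ^ 8))"
    proof -
      have "cmod (2 * of_nat (2*n+1)) = real (2 * (2*n+1))"
        by (simp only: norm_mult norm_of_nat) simp
      then have "cmod (1 / (2 * of_nat (2*n+1))) \<le> 1" by (simp add: norm_divide)
      moreover have "cmod (?T k) / (cmod ?A * cmod ?B) \<le> cmod (?T k) / (d^2 * real (Suc k) ^ 8)"
        using AB pos by (intro frac_le) simp_all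
      ultimately show ?thesis using w by (intro mult_mono) auto
    qed
    also have "\<dots> = 1 / d^2 * norm (?T k / of_nat (Suc k) ^ 8)"
      by (simp add: norm_divide norm_power del: of_nat_Suc)
    finally show "norm (wz_G x y n k) \<le> 1 / d^2 * norm (?T k / of_nat (Suc k) ^ 8)" .
  qed
  show "(\<lambda>k. 1 / d^2 * norm (?T k / of_nat (Suc k) ^ 8)) \<longlonglongrightarrow> 0"
    by (intro tendsto_mult_right_zero tendsto_norm_zero wz_cert_tendsto_0)
qed

text \<open>Summing the WZ relation over \<open>k\<close> telescopes the right side; the far
  boundary vanishes by \<open>wz_G_tendsto_0\<close>, leaving \<open>wz_G x y n 0\<close>.\<close>

lemma wz_row_sums_diff:
  "(\<Sum>k. wz_F x y n k) - (\<Sum>k. wz_F x y (Suc n) k) = rhs_term x y (Suc n)"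
proof -
  have "(\<lambda>k. wz_F x y n k - wz_F x y (Suc n) k) sums (wz_G x y n 0 - 0)"
    using telescope_sums'[OF wz_G_tendsto_0] by (simp only: wz_relation[OF quartic_nonzero])
  moreover have "(\<lambda>k. wz_F x y n k - wz_F x y (Suc n) k) sums
      ((\<Sum>k. wz_F x y n k) - (\<Sum>k. wz_F x y (Suc n) k))"
    by (intro sums_diff summable_sums wz_F_summable)
  ultimately show ?thesis
    using sums_unique2 by (fastforce simp: wz_G_0)
qed

lemma rhs_term_sums: "(\<lambda>n. rhs_term x y (Suc n)) sums (\<Sum>k. wz_F x y 0 k)"
  using telescope_sums'[OF wz_row_sums_tendsto_0] by (simp add: wz_row_sums_diff)

end

lemma wz_F_0: "wz_F x y 0 k = 2 * lhs_term x y (Suc k)"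
  by (simp add: wz_F_def wz_coeff_def lhs_term_def quartic_def algebra_simps)

theorem theorem2:
  fixes x y :: complex
  assumes "cmod x ^ 2 + cmod y ^ 4 < 1"
  shows "summable (\<lambda>k. lhs_term x y (Suc k))
       \<and> summable (\<lambda>n. rhs_term x y (Suc n))
       \<and> (\<Sum>k. lhs_term x y (Suc k)) = 1 / 2 * (\<Sum>n. rhs_term x y (Suc n))"
proof -
  have lhs: "lhs_term x y (Suc k) = 1 / 2 * wz_F x y 0 k" for k
    by (simp add: wz_F_0)
  show ?thesis
    unfolding lhs
    using rhs_term_sums[OF assms] wz_F_summable[OF assms, of 0]
    by (auto simp only: summable_mult suminf_mult sums_iff)
qed

end
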